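(* Let $n$ be a positive integer and let $b_1,\dots,b_n$ be positive integers with $\sum_{1\le i<j\le n}\frac{1}{b_ib_j}<1$. Then $$\sum_{1\le i<j\le n}\frac{1}{b_ib_j}\le \sum_{1\le i<j\le n}\frac{1}{v_iv_j}=1-\frac{1}{v_1v_2\cdots v_n}$$ and $$\sum_{i=1}^n\frac{1}{b_i}\le \sum_{i=1}^n\frac{1}{v_i}.$$
   Context: The sequence $(v_n)_{n\ge1}$ is defined recursively by $v_1=1$, $v_2=2$, and for $n\ge 2$ $$v_{n+1}=1+\frac{\sum_{1\le i\le n}\frac{1}{v_i}}{1-\sum_{1\le i<j\le n}\frac{1}{v_iv_j}}.$$ Its first terms are $1,2,4,15,219,47863,\dots$; it is an increasing sequence of positive integers. *)

theory Defs
  imports Complex_Main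
begin

definition pairs :: "nat \<Rightarrow> (nat \<times> nat) set" where
  "pairs n = {(i, j). 1 \<le> i \<and> i < j \<and> j \<le> n}"

lemma finite_pairs [simp]: "finite (pairs n)"
  by (rule finite_subset[of _ "{..n} \<times> {..n}"]) (auto simp: pairs_def)

(* The sequence is indexed from 1; vseq 0 is a dummy value. The values are taken in the reals
   so that the division is exact; that they are positive integers is not built in. *)
function vseq :: "nat \<Rightarrow> real" where
  "vseq 0 = 0"
| "vseq (Suc 0) = 1"
| "vseq (Suc (Suc 0)) = 2"
| "vseq (Suc (Suc (Suc k))) =
     1 + (\<Sum>i\<in>{1..k+2}. 1 / vseq i) / (1 - (\<Sum>(i, j)\<in>pairs (k+2). 1 / (vseq i * vseq j)))"
  by pat_completeness auto
termination
  by (relation "measure id") (auto simp: pairs_def)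

lemma vseq_rec:
  assumes "n \<ge> 2"
  shows "vseq (n + 1) =
    1 + (\<Sum>i\<in>{1..n}. 1 / vseq i) / (1 - (\<Sum>(i, j)\<in>pairs n. 1 / (vseq i * vseq j)))"
proof -
  obtain k where "n = k + 2"
    using assms by (metis add.commute le_Suc_ex)
  then show ?thesis
    using vseq.simps(4)[of k] by (simp add: numeral_2_eq_2)
qed

end

(* Write x_i = 1/b_i with b increasing and y_i = 1/v_i, and let E_k be the second elementary
   symmetric function of the first k entries.  If E_n(y) < E_n(x) while E_k(x) <= E_k(y) for all
   k < n, then x is flatter than y and prod x >= prod y, so prod b <= prod v.  As 1 - E_n(x) is a
   positive multiple of 1 / prod b, this gives E_n(x) <= 1 - 1 / prod v = E_n(y), a contradiction.
   For the sums: if sum y < sum x although every shorter prefix sum of x is at most that of y,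
   then E_n(y) < E_n(x), because E_n is increasing and Schur-concave. *)

theory Submission
  imports Defs "HOL-Library.Multiset"
begin

section \<open>First and second elementary symmetric functions of prefixes\<close>

definition esum :: "(nat \<Rightarrow> real) \<Rightarrow> nat \<Rightarrow> real" where
  "esum a n = (\<Sum>i\<in>{1..n}. a i)"

definition epairs :: "(nat \<Rightarrow> real) \<Rightarrow> nat \<Rightarrow> real" where
  "epairs a n = (\<Sum>(i, j)\<in>pairs n. a i * a j)"

lemma esum_simps [simp]:
  "esum a 0 = 0"
  "esum a (Suc n) = esum a n + a (Suc n)"
  by (simp_all add: esum_def)

lemma pairs_Suc: "pairs (Suc n) = pairs n \<union> (\<lambda>i. (i, Suc n)) ` {1..n}"
  by (auto simp: pairs_def le_Suc_eq)

lemma epairs_simps [simp]: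
  "epairs a 0 = 0"
  "epairs a (Suc n) = epairs a n + esum a n * a (Suc n)"
proof -
  show "epairs a 0 = 0"
    by (auto simp: epairs_def pairs_def intro!: sum.neutral)
  have "epairs a (Suc n) =
      epairs a n + (\<Sum>(i, j)\<in>(\<lambda>i. (i, Suc n)) ` {1..n}. a i * a j)"
    unfolding epairs_def pairs_Suc
    by (rule sum.union_disjoint) (auto simp: finite_pairs, auto simp: pairs_def)
  also have "(\<Sum>(i, j)\<in>(\<lambda>i. (i, Suc n)) ` {1..n}. a i * a j) = esum a n * a (Suc n)"
    by (subst sum.reindex) (auto simp: inj_on_def esum_def sum_distrib_right)
  finally show "epairs a (Suc n) = epairs a n + esum a n * a (Suc n)" .
qed

text \<open>Newton's identity in degree two. Writing \<open>epairs\<close> through sums over single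
  indices gives both its change under updates and its symmetry under rearrangement.\<close>

lemma epairs_eq: "epairs a n = ((esum a n)\<^sup>2 - esum (\<lambda>i. (a i)\<^sup>2) n) / 2"
  by (induction n) (auto simp: power2_eq_square field_simps)

lemma esum_cong:
  assumes "\<And>i. i \<in> {1..n} \<Longrightarrow> a i = c i"
  shows "esum a n = esum c n"
  unfolding esum_def using assms by (intro sum.cong) auto

lemma epairs_cong:
  assumes "\<And>i. i \<in> {1..n} \<Longrightarrow> a i = c i"
  shows "epairs a n = epairs c n"
  unfolding epairs_def using assms
  by (intro sum.cong refl) (auto simp: pairs_def)

lemma esum_pos:
  assumes "n \<ge> 1" "\<And>i. i \<in> {1..n} \<Longrightarrow> a i > 0"
  shows "esum a n > 0"
  unfolding esum_def using assms by (intro sum_pos) auto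

lemma epairs_mono:
  assumes "\<And>i. i \<in> {1..n} \<Longrightarrow> 0 < a i \<and> a i \<le> c i"
  shows "epairs a n \<le> epairs c n"
proof -
  have "a i * a j \<le> c i * c j" if "(i, j) \<in> pairs n" for i j
  proof -
    have "i \<in> {1..n}" "j \<in> {1..n}" using that by (auto simp: pairs_def)
    then show ?thesis using assms[of i] assms[of j] by (intro mult_mono) linarith+
  qed
  then show ?thesis unfolding epairs_def by (intro sum_mono) auto
qed

lemma epairs_mono_length:
  assumes "m \<le> n" "\<And>i. i \<in> {1..n} \<Longrightarrow> a i > 0"
  shows "epairs a m \<le> epairs a n"
  unfolding epairs_def
proof (rule sum_mono2)
  show "pairs m \<subseteq> pairs n" using assms(1) by (auto simp: pairs_def)
  fix p assume "p \<in> pairs n - pairs m"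
  then obtain i j where "p = (i, j)" "i \<in> {1..n}" "j \<in> {1..n}" by (auto simp: pairs_def)
  then show "0 \<le> (case p of (i, j) \<Rightarrow> a i * a j)"
    using assms(2)[of i] assms(2)[of j] by simp
qed simp

lemma esum_fun_upd:
  assumes "i \<in> {1..n}"
  shows "esum (a(i := c)) n = esum a n + (c - a i)"
proof -
  have "esum (a(i := c)) n = c + (\<Sum>l\<in>{1..n} - {i}. a l)"
    unfolding esum_def using assms by (subst sum.remove[of _ i]) auto
  moreover have "esum a n = a i + (\<Sum>l\<in>{1..n} - {i}. a l)"
    unfolding esum_def using assms by (subst sum.remove[of _ i]) auto
  ultimately show ?thesis by simp
qed

text \<open>\<open>epairs\<close> is affine in each entry, with slope the sum of the other
  entries.\<close>

lemma epairs_fun_upd: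
  assumes "i \<in> {1..n}"
  shows "epairs (a(i := c)) n = epairs a n + (c - a i) * (esum a n - a i)"
proof -
  have "(\<lambda>l. ((a(i := c)) l)\<^sup>2) = (\<lambda>l. (a l)\<^sup>2)(i := c\<^sup>2)"
    by auto
  then have "esum (\<lambda>l. ((a(i := c)) l)\<^sup>2) n = esum (\<lambda>l. (a l)\<^sup>2) n + (c\<^sup>2 - (a i)\<^sup>2)"
    using esum_fun_upd[OF assms, of "\<lambda>l. (a l)\<^sup>2" "c\<^sup>2"] by simp
  then show ?thesis
    unfolding epairs_eq esum_fun_upd[OF assms]
    by (simp add: power2_eq_square field_simps)
qed

lemma esum_gt_term:
  assumes "n \<ge> 2" "i \<in> {1..n}" "\<And>l. l \<in> {1..n} \<Longrightarrow> a l > 0"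
  shows "a i < esum a n"
proof -
  obtain j where j: "j \<in> {1..n}" "j \<noteq> i"
  proof (cases "i = 1")
    case True
    then show ?thesis using that[of 2] assms(1) by auto
  next
    case False
    then show ?thesis using that[of 1] assms(1) by auto
  qed
  have "a i < a i + a j" using assms j by simp
  also have "\<dots> = sum a {i, j}" using j by simp
  also have "\<dots> \<le> esum a n"
    unfolding esum_def using assms j by (intro sum_mono2) (auto intro: less_imp_le)
  finally show ?thesis .
qed

text \<open>For at least two positive entries the slope of \<open>epairs\<close> in each entry is
  positive, so raising \<open>a i\<close> to \<open>c i\<close> alone would already increase it
  strictly.\<close>

lemma epairs_le_imp_eq:
  assumes n: "n \<ge> 2" and le: "\<And>i. i \<in> {1..n} \<Longrightarrow> 0 < a i \<and> a i \<le> c i"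
    and "epairs c n \<le> epairs a n" and i: "i \<in> {1..n}"
  shows "a i = c i"
proof (rule ccontr)
  assume "a i \<noteq> c i"
  with le i have lt: "a i < c i" by force
  have "epairs (a(i := c i)) n \<le> epairs c n"
    using le i lt by (intro epairs_mono) (auto intro: order.strict_trans)
  moreover have "(c i - a i) * (esum a n - a i) > 0"
    using esum_gt_term[of n i a] n le i lt by simp
  ultimately show False
    using assms(3) epairs_fun_upd[OF i, of a "c i"] by linarith
qed

section \<open>Comparison of products by spreading pairs\<close>

text \<open>Moving \<open>a\<close> up and \<open>b\<close> down along the hyperbola \<open>(a + R) * (b + R) = const\<close> keeps \<open>epairs\<close>
  fixed when \<open>R\<close> is the sum of the other entries.\<close>

lemma hyperbola_spread:
  fixes a b A B R :: real
  assumes "0 \<le> R" "0 < B" "B < b" "b \<le> a" "a < A"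
  obtains a' b' where "a \<le> a'" "a' \<le> A" "B \<le> b'" "b' \<le> b" "a' = A \<or> b' = B"
    "a' * b' + R * (a' + b') = a * b + R * (a + b)" "a + b \<le> a' + b'" "a' * b' \<le> a * b"
proof -
  define C where "C = (a + R) * (b + R)"
  have "\<exists>a' b'. a \<le> a' \<and> a' \<le> A \<and> B \<le> b' \<and> b' \<le> b \<and> (a' = A \<or> b' = B) \<and>
      (a' + R) * (b' + R) = C"
  proof (cases "(A + R) * (B + R) \<le> C")
    \<comment> \<open>Here \<open>B\<close> is reached no later than \<open>A\<close> only in case
      of equality: stopping at \<open>a' = A\<close> leaves \<open>b' \<ge> B\<close>. In the other
      case \<open>b'\<close> stops at \<open>B\<close> while \<open>a'\<close> is still below
      \<open>A\<close>.\<close>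
    case True
    have "C \<le> (A + R) * (b + R)"
      unfolding C_def using assms by (intro mult_right_mono) auto
    then show ?thesis
      using assms True
      by (intro exI[of _ A] exI[of _ "C / (A + R) - R"]) (auto simp: field_simps)
  next
    case False
    have "(a + R) * (B + R) \<le> C"
      unfolding C_def using assms by (intro mult_left_mono) auto
    then show ?thesis
      using assms False
      by (intro exI[of _ "C / (B + R) - R"] exI[of _ B]) (auto simp: field_simps)
  qed
  then obtain a' b' where *: "a \<le> a'" "a' \<le> A" "B \<le> b'" "b' \<le> b" "a' = A \<or> b' = B"
    "(a' + R) * (b' + R) = C" by blast
  have eq: "a' * b' + R * (a' + b') = a * b + R * (a + b)"
    using *(6) unfolding C_def by (simp add: algebra_simps)
  \<comment> \<open>Along the hyperbola, \<open>a\<close> gains at least what \<open>b\<close>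
    loses, since \<open>a + R \<ge> b' + R\<close>.\<close>
  have "(b' + R) * (a' - a) = (b - b') * (a + R)"
    using *(6) unfolding C_def by (simp add: algebra_simps)
  also have "\<dots> \<ge> (b - b') * (b' + R)"
    using assms * by (intro mult_left_mono) auto
  finally have "(b' + R) * (b - b') \<le> (b' + R) * (a' - a)" by (simp add: mult.commute)
  then have sum: "a + b \<le> a' + b'"
    using assms * by (subst (asm) mult_le_cancel_left_pos) auto
  then have "R * (a + b) \<le> R * (a' + b')" using assms by (intro mult_left_mono) auto
  then have "a' * b' \<le> a * b" using eq by linarith
  then show thesis using that * eq sum by blast
qed

lemma epairs_fun_upd2:
  assumes "i \<in> {1..n}" "j \<in> {1..n}" "i \<noteq> j"
  shows "epairs (a(i := c, j := d)) n = epairs a n + (c * d - a i * a j)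
    + (esum a n - a i - a j) * (c + d - a i - a j)"
  using assms by (simp add: epairs_fun_upd esum_fun_upd algebra_simps)

lemma prod_fun_upd2:
  fixes a :: "nat \<Rightarrow> real"
  assumes "i \<in> S" "j \<in> S" "i \<noteq> j" "finite S"
  shows "(\<Prod>l\<in>S. (a(i := c, j := d)) l) = c * d * (\<Prod>l\<in>S - {i, j}. a l)"
proof -
  have "(\<Prod>l\<in>S. (a(i := c, j := d)) l) = (\<Prod>l\<in>{i, j} \<union> (S - {i, j}). (a(i := c, j := d)) l)"
    using assms by (intro prod.cong) auto
  also have "\<dots> = (\<Prod>l\<in>{i, j}. (a(i := c, j := d)) l) * (\<Prod>l\<in>S - {i, j}. (a(i := c, j := d)) l)"
    using assms by (intro prod.union_disjoint) auto
  also have "(\<Prod>l\<in>S - {i, j}. (a(i := c, j := d)) l) = (\<Prod>l\<in>S - {i, j}. a l)"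
    by (intro prod.cong) auto
  finally show ?thesis using assms(3) by (simp del: fun_upd_apply) (simp add: assms(3))
qed

text \<open>As long as some \<open>x i < y i\<close> precedes some \<open>x j > y j\<close>, spread that pair until one of the two
  agrees with \<open>y\<close>; this preserves every hypothesis and lowers the product.\<close>

lemma prod_le_if_epairs_le:
  fixes x y :: "nat \<Rightarrow> real"
  assumes n: "n \<ge> 2"
    and x: "\<And>i. i \<in> {1..n} \<Longrightarrow> x i > 0" and y: "\<And>i. i \<in> {1..n} \<Longrightarrow> y i > 0"
    and first: "x 1 \<le> y 1"
    and before: "\<And>k. k < n \<Longrightarrow> epairs x k \<le> epairs y k"
    and last: "epairs y n \<le> epairs x n"
    and order: "\<And>i j. 1 \<le> i \<Longrightarrow> i < j \<Longrightarrow> j \<le> n \<Longrightarrow> x i < y i \<Longrightarrow> y j < x j \<Longrightarrow> x j \<le> x i"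
  shows "(\<Prod>i\<in>{1..n}. y i) \<le> (\<Prod>i\<in>{1..n}. x i)"
  using x first before last order
proof (induction "card {i \<in> {1..n}. x i \<noteq> y i}" arbitrary: x rule: less_induct)
  case less
  note x = less.prems(1) and first = less.prems(2) and before = less.prems(3)
    and last = less.prems(4) and order = less.prems(5)
  show ?case
  proof (cases "\<exists>j. 1 \<le> j \<and> j \<le> n \<and> y j < x j")
    case False
    \<comment> \<open>Without any excess over \<open>y\<close>, the hypothesis \<open>last\<close>
      leaves only equality.\<close>
    then have "x i = y i" if "i \<in> {1..n}" for i
      using epairs_le_imp_eq[OF n, of x y, OF _ last that] x by force
    then show ?thesis by simp
  next
    case True
    \<comment> \<open>Taking the first excess keeps every earlier entry at most its counterpart in
      \<open>y\<close>, which controls the prefixes that end before \<open>j\<close>.\<close>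
    define j where "j = (LEAST j. 1 \<le> j \<and> j \<le> n \<and> y j < x j)"
    have j: "1 \<le> j" "j \<le> n" "y j < x j"
      using LeastI_ex[OF True] by (simp_all add: j_def)
    have below_j: "x i \<le> y i" if "1 \<le> i" "i < j" for i
      using not_less_Least[of i "\<lambda>j. 1 \<le> j \<and> j \<le> n \<and> y j < x j"] that j by (force simp: j_def)
    have j1: "j \<noteq> 1" using j first by auto
    show ?thesis
    proof (cases "\<exists>i. 1 \<le> i \<and> i < j \<and> x i < y i")
      case False
      \<comment> \<open>With agreement before \<open>j\<close>, the excess at \<open>j\<close> makes
        \<open>epairs x j\<close> larger than \<open>epairs y j\<close>. So \<open>before\<close>
        forces \<open>j = n\<close>, and \<open>x\<close> dominates \<open>y\<close>
        entrywise.\<close>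
      then have eq: "x i = y i" if "1 \<le> i" "i < j" for i
        using below_j that by force
      obtain m where m: "j = Suc m" "m \<ge> 1"
        using j j1 by (metis Suc_le_D le_neq_implies_less less_Suc_eq_le One_nat_def)
      have "epairs x m = epairs y m" "esum x m = esum y m"
        using eq m by (auto intro!: epairs_cong esum_cong)
      moreover have "esum y m > 0" using y m j by (intro esum_pos) auto
      ultimately have "epairs y j < epairs x j" using m j by simp
      with before[of j] j have "j = n" by force
      then show ?thesis
        using eq j y by (intro prod_mono) (auto simp: less_imp_le le_less)
    next
      case True
      then obtain i where i: "1 \<le> i" "i < j" "x i < y i" by blast
      have ij: "i \<in> {1..n}" "j \<in> {1..n}" "i \<noteq> j" using i j by auto
      define R where "R = esum x n - x i - x j"
      have R_ge: "esum x k - x i - x j \<le> R" if "k \<le> n" for k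
      proof -
        have "esum x k \<le> esum x n"
          unfolding esum_def using x that by (intro sum_mono2) (auto intro: less_imp_le)
        then show ?thesis by (simp add: R_def)
      qed
      have "sum x {i, j} \<le> esum x n"
        unfolding esum_def using x ij by (intro sum_mono2) (auto intro: less_imp_le)
      then have "R \<ge> 0" using ij by (simp add: R_def)
      \<comment> \<open>\<open>order\<close> gives \<open>x j \<le> x i\<close>, so moving
        \<open>x i\<close> up and \<open>x j\<close> down increases their distance, and the product
        falls.\<close>
      then obtain a b where ab: "x i \<le> a" "a \<le> y i" "y j \<le> b" "b \<le> x j" "a = y i \<or> b = y j"
        "a * b + R * (a + b) = x i * x j + R * (x i + x j)" "x i + x j \<le> a + b" "a * b \<le> x i * x j"
        using hyperbola_spread[of R "y j" "x j" "x i" "y i"] y[OF ij(2)] j(3) i order[of i j] j by blast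
      define u where "u = x(i := a, j := b)"
      have ui: "u i = a" and uj: "u j = b" and u_other: "\<And>l. l \<noteq> i \<Longrightarrow> l \<noteq> j \<Longrightarrow> u l = x l"
        using ij by (auto simp: u_def)
      have epairs_u: "epairs u k = epairs x k + (a * b - x i * x j)
          + (esum x k - x i - x j) * (a + b - x i - x j)" if "j \<le> k" "k \<le> n" for k
        unfolding u_def using that i by (intro epairs_fun_upd2) auto
      \<comment> \<open>Both \<open>i\<close> and \<open>j\<close> were disagreements; one of them
        is repaired and no other position changes.\<close>
      have "card {l \<in> {1..n}. u l \<noteq> y l} < card {l \<in> {1..n}. x l \<noteq> y l}"
      proof (rule psubset_card_mono)
        have "{l \<in> {1..n}. u l \<noteq> y l} \<subseteq> {l \<in> {1..n}. x l \<noteq> y l}"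
        proof (rule subsetI)
          fix l
          assume l: "l \<in> {l \<in> {1..n}. u l \<noteq> y l}"
          then show "l \<in> {l \<in> {1..n}. x l \<noteq> y l}"
            using u_other[of l] i(3) j(3) by (cases "l = i \<or> l = j") auto
        qed
        moreover have "\<exists>l\<in>{i, j}. u l = y l"
          using ab(5) ui uj by blast
        then have "{l \<in> {1..n}. u l \<noteq> y l} \<noteq> {l \<in> {1..n}. x l \<noteq> y l}"
          using ij i(3) j(3) by force
        ultimately show "{l \<in> {1..n}. u l \<noteq> y l} \<subset> {l \<in> {1..n}. x l \<noteq> y l}"
          by blast
      qed simp
      moreover have u_pos: "u l > 0" if "l \<in> {1..n}" for l
        using that x[of l] x[of i] y[of j] ij ab by (auto simp: u_def)
      moreover have "u 1 \<le> y 1"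
        using first ab j1 by (auto simp: u_def)
      moreover have "epairs u k \<le> epairs y k" if k: "k < n" for k
      proof (cases "j \<le> k")
        case True
        \<comment> \<open>The invariant balances the product loss against \<open>R\<close> times the
          gain of the sum. In a shorter prefix the other entries add up to at most \<open>R\<close>,
          so \<open>epairs\<close> cannot rise.\<close>
        have "(esum x k - x i - x j) * (a + b - x i - x j) \<le> R * (a + b - x i - x j)"
          using R_ge[of k] k ab(7) by (intro mult_right_mono) auto
        also have "\<dots> = x i * x j - a * b" using ab(6) by (simp add: algebra_simps)
        finally show ?thesis using epairs_u[of k] True k before[of k] by simp
      next
        case False
        have "0 < u l \<and> u l \<le> y l" if l: "l \<in> {1..k}" for l
          using u_pos[of l] below_j[of l] ab(2) l k False by (cases "l = i") (auto simp: u_def)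
        then show ?thesis by (intro epairs_mono)
      qed
      moreover have "epairs y n \<le> epairs u n"
      proof -
        have "R * (a + b - x i - x j) = x i * x j - a * b"
          using ab(6) by (simp add: algebra_simps)
        then show ?thesis using epairs_u[of n] j last by (simp add: R_def[symmetric])
      qed
      moreover have "u q \<le> u p"
        if "1 \<le> p" "p < q" "q \<le> n" "u p < y p" "y q < u q" for p q
      proof -
        \<comment> \<open>Entries still below \<open>y\<close> were at most raised, entries still
          above it at most lowered, so the restricted form of \<open>order\<close> survives the
          spread.\<close>
        have "x p \<le> u p" "u q \<le> x q"
          using that ab ij by (auto simp: u_def split: if_splits)
        then show ?thesis using order[of p q] that by linarith
      qed
      ultimately have "(\<Prod>l\<in>{1..n}. y l) \<le> (\<Prod>l\<in>{1..n}. u l)"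
        by (rule less.hyps)
      also have "\<dots> = a * b * (\<Prod>l\<in>{1..n} - {i, j}. x l)"
        unfolding u_def using ij by (intro prod_fun_upd2) auto
      also have "\<dots> \<le> x i * x j * (\<Prod>l\<in>{1..n} - {i, j}. x l)"
        using ab(8) x by (intro mult_right_mono prod_nonneg) (auto intro: less_imp_le)
      also have "\<dots> = (\<Prod>l\<in>{1..n}. x l)"
        using prod_fun_upd2[OF ij(1,2,3), of x "x i" "x j"] by simp
      finally show ?thesis .
    qed
  qed
qed

section \<open>Comparison of sums\<close>

text \<open>Abel summation: every proper prefix sum is nonnegative, so replacing its weight by a
  later, smaller one can only lower the total. The full sum may be negative.\<close>

lemma esum_weighted_ge:
  assumes "\<And>k. k < n \<Longrightarrow> esum z k \<ge> 0" "\<And>i. 1 \<le> i \<Longrightarrow> Suc i \<le> n \<Longrightarrow> c (Suc i) \<le> c i"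
  shows "c n * esum z n \<le> esum (\<lambda>i. z i * c i) n"
  using assms
proof (induction n)
  case (Suc n)
  have "c (Suc n) * esum z n \<le> c n * esum z n"
  \<comment> \<open>Nothing relates \<open>c 1\<close> to \<open>c 0\<close>, but for
    \<open>n = 0\<close> the prefix sum is zero.\<close>
  proof (cases "n = 0")
    case False
    then show ?thesis using Suc.prems by (intro mult_right_mono) auto
  qed simp
  also have "\<dots> \<le> esum (\<lambda>i. z i * c i) n" using Suc by simp
  finally show ?case by (simp add: algebra_simps)
qed simp

text \<open>With \<open>z = y - x\<close> and \<open>c = x + y\<close>, the sum of
  \<open>z i * c i\<close> is a difference of sums of squares. Newton's identity and Abel summation
  bound \<open>c n * esum z n\<close> by \<open>(esum x n + esum y n) * esum z n\<close>. As
  \<open>n \<ge> 2\<close>, \<open>c n\<close> is less than the first factor, so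
  \<open>esum z n\<close> is nonnegative.\<close>

lemma esum_le_if_epairs_le:
  assumes x: "\<And>i. i \<in> {1..n} \<Longrightarrow> x i > 0" and y: "\<And>i. i \<in> {1..n} \<Longrightarrow> y i > 0"
    and n: "n \<ge> 2"
    and antimono: "\<And>i. 1 \<le> i \<Longrightarrow> Suc i \<le> n \<Longrightarrow> x (Suc i) \<le> x i"
      "\<And>i. 1 \<le> i \<Longrightarrow> Suc i \<le> n \<Longrightarrow> y (Suc i) \<le> y i"
    and before: "\<And>k. k < n \<Longrightarrow> esum x k \<le> esum y k"
    and epairs: "epairs x n \<le> epairs y n"
  shows "esum x n \<le> esum y n"
proof -
  define z where "z = (\<lambda>i. y i - x i)"
  define c where "c = (\<lambda>i. x i + y i)"
  have z: "esum z k = esum y k - esum x k" for k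
    by (simp add: z_def esum_def sum_subtractf)
  have "esum (\<lambda>i. z i * c i) n = esum (\<lambda>i. (y i)\<^sup>2) n - esum (\<lambda>i. (x i)\<^sup>2) n"
    by (simp add: z_def c_def esum_def sum_subtractf[symmetric] power2_eq_square algebra_simps)
  moreover have "c n * esum z n \<le> esum (\<lambda>i. z i * c i) n"
    using before antimono by (intro esum_weighted_ge) (auto simp: z c_def intro: add_mono)
  ultimately have "c n * esum z n \<le> (esum y n)\<^sup>2 - (esum x n)\<^sup>2"
    using epairs by (simp add: epairs_eq)
  then have "0 \<le> (esum x n + esum y n - c n) * esum z n"
    unfolding z by (simp add: power2_eq_square algebra_simps)
  moreover have "esum x n + esum y n - c n > 0"
    using esum_gt_term[OF n, of n x] esum_gt_term[OF n, of n y] n x y by (auto simp: c_def)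
  ultimately show ?thesis by (simp add: zero_le_mult_iff z)
qed

section \<open>The sequence \<open>vseq\<close>: closed form and monotonicity\<close>

text \<open>The recurrence also yields the second term, \<open>2 = 1 + 1 / (1 - 0)\<close>, so later
  arguments can start from \<open>n = 1\<close>.\<close>

lemma vseq_Suc:
  assumes "n \<ge> 1"
  shows "vseq (Suc n) = 1 + esum (\<lambda>i. 1 / vseq i) n / (1 - epairs (\<lambda>i. 1 / vseq i) n)"
proof (cases "n = 1")
  case True
  then show ?thesis by (simp add: numeral_2_eq_2)
next
  case False
  with assms have "n \<ge> 2" by simp
  from vseq_rec[OF this] show ?thesis by (simp add: esum_def epairs_def)
qed

text \<open>The two claims support each other. With \<open>P\<close> the product and
  \<open>S\<close> the reciprocal sum, the closed form turns the recurrence into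
  \<open>vseq (Suc n) = 1 + S * P\<close>, which is at least 1; the next closed form is then
  \<open>1 - 1/P + S/(1 + S*P) = 1 - 1/(P*(1 + S*P))\<close>.\<close>

lemma vseq_ge_1_and_epairs:
  assumes "n \<ge> 1"
  shows "(\<forall>i\<in>{1..n}. vseq i \<ge> 1) \<and>
    epairs (\<lambda>i. 1 / vseq i) n = 1 - 1 / (\<Prod>i\<in>{1..n}. vseq i)"
  using assms
proof (induction n rule: dec_induct)
  case base
  then show ?case by simp
next
  case (step n)
  define P where "P = (\<Prod>i\<in>{1..n}. vseq i)"
  define S where "S = esum (\<lambda>i. 1 / vseq i) n"
  have ge: "vseq i \<ge> 1" if "i \<in> {1..n}" for i using step that by blast
  have "P > 0" unfolding P_def using ge by (intro prod_pos) force
  have "S \<ge> 0" unfolding S_def esum_def using ge by (intro sum_nonneg) force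
  have v: "vseq (Suc n) = 1 + S * P"
    using vseq_Suc[OF step(1)] step by (simp add: P_def S_def)
  have pos: "1 + S * P > 0" "S * P \<ge> 0" using \<open>P > 0\<close> \<open>S \<ge> 0\<close> by (auto intro: add_pos_nonneg)
  have "epairs (\<lambda>i. 1 / vseq i) (Suc n) = 1 - 1 / P + S / (1 + S * P)"
    using step v by (simp add: P_def S_def)
  also have "\<dots> = 1 - 1 / (P * (1 + S * P))"
    using \<open>P > 0\<close> pos by (simp add: divide_simps) (simp add: algebra_simps)
  finally show ?case
    using ge pos v by (auto simp: P_def le_Suc_eq)
qed

lemma vseq_ge_1: "n \<ge> 1 \<Longrightarrow> vseq n \<ge> 1"
  using vseq_ge_1_and_epairs[of n] by simp

lemma epairs_vseq:
  "n \<ge> 1 \<Longrightarrow> epairs (\<lambda>i. 1 / vseq i) n = 1 - 1 / (\<Prod>i\<in>{1..n}. vseq i)"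
  using vseq_ge_1_and_epairs by blast

text \<open>In \<open>vseq (Suc k) = 1 + S k * P k\<close> both factors are nondecreasing in
  \<open>k\<close>.\<close>

lemma vseq_le_Suc:
  assumes "n \<ge> 1"
  shows "vseq n \<le> vseq (Suc n)"
proof (cases "n = 1")
  case True
  then show ?thesis by (simp add: numeral_2_eq_2)
next
  case False
  with assms obtain m where m: "n = Suc m" "m \<ge> 1" by (cases n) auto
  define P where "P = (\<lambda>n. \<Prod>i\<in>{1..n}. vseq i)"
  define S where "S = esum (\<lambda>i. 1 / vseq i)"
  have v: "vseq (Suc k) = 1 + S k * P k" if "k \<ge> 1" for k
    using that by (simp add: vseq_Suc epairs_vseq P_def S_def)
  have "P m > 0" unfolding P_def using vseq_ge_1 by (intro prod_pos) force
  moreover have "S m > 0" unfolding S_def using m vseq_ge_1 by (intro esum_pos) force+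
  moreover have "S m \<le> S n" "P m \<le> P n"
    using m vseq_ge_1[of n] \<open>P m > 0\<close> by (auto simp: S_def P_def)
  ultimately have "S m * P m \<le> S n * P n" by (intro mult_mono) auto
  then show ?thesis using v[of m] v[of n] m by simp
qed

section \<open>Integrality gap below 1\<close>

text \<open>Both numerators are carried together because appending an entry adds the numerator of
  \<open>esum\<close> to that of \<open>epairs\<close>.\<close>

lemma common_denominator:
  fixes b :: "nat \<Rightarrow> nat"
  assumes "\<And>i. i \<in> {1..n} \<Longrightarrow> b i > 0"
  shows "\<exists>(p :: nat) (q :: nat). esum (\<lambda>i. 1 / b i) n = p / (\<Prod>i\<in>{1..n}. b i) \<and>
    epairs (\<lambda>i. 1 / b i) n = q / (\<Prod>i\<in>{1..n}. b i)"
  using assms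
proof (induction n)
  case 0
  show ?case by (auto intro: exI[of _ "0::nat"])
next
  case (Suc n)
  then obtain p :: nat and q :: nat where pq: "esum (\<lambda>i. 1 / b i) n = p / (\<Prod>i\<in>{1..n}. b i)"
    "epairs (\<lambda>i. 1 / b i) n = q / (\<Prod>i\<in>{1..n}. b i)"
    by fastforce
  define P where "P = (\<Prod>i\<in>{1..n}. b i)"
  have P: "(\<Prod>i\<in>{1..Suc n}. b i) = P * b (Suc n)" "P > 0" "b (Suc n) > 0"
    using Suc.prems by (auto simp: P_def)
  have "esum (\<lambda>i. 1 / b i) (Suc n) = real (p * b (Suc n) + P) / real (P * b (Suc n))"
    "epairs (\<lambda>i. 1 / b i) (Suc n) = real (q * b (Suc n) + p) / real (P * b (Suc n))"
    using P(2,3) by (simp_all add: pq[folded P_def] field_simps)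
  then show ?case unfolding P(1) by blast
qed

text \<open>A fraction below 1 with denominator \<open>P\<close> and integer numerator misses 1 by
  at least \<open>1 / P\<close>.\<close>

lemma epairs_le_if_less_1:
  fixes b :: "nat \<Rightarrow> nat"
  assumes "\<And>i. i \<in> {1..n} \<Longrightarrow> b i > 0" "epairs (\<lambda>i. 1 / b i) n < 1"
  shows "epairs (\<lambda>i. 1 / b i) n \<le> 1 - 1 / (\<Prod>i\<in>{1..n}. real (b i))"
proof -
  define P where "P = (\<Prod>i\<in>{1..n}. b i)"
  have "P > 0" using assms by (auto simp: P_def)
  obtain q :: nat where q: "epairs (\<lambda>i. 1 / b i) n = q / P"
    using common_denominator[of n b] assms(1) unfolding P_def by blast
  with assms(2) \<open>P > 0\<close> have "q < P" by (simp add: field_simps)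
  then have "real q + 1 \<le> real P" by linarith
  then have "q / P \<le> 1 - 1 / P" using \<open>P > 0\<close> by (simp add: field_simps)
  then show ?thesis using q by (simp add: P_def)
qed

section \<open>Induction for sorted denominators, and reduction to that case\<close>

text \<open>One induction serves both bounds: the prefix bounds on \<open>epairs\<close> feed the
  product comparison, those on \<open>esum\<close> the sum comparison. Prefixes inherit sortedness
  and \<open>epairs < 1\<close>.\<close>

lemma epairs_esum_le_vseq:
  fixes b :: "nat \<Rightarrow> nat"
  assumes "\<And>i. i \<in> {1..n} \<Longrightarrow> b i > 0" "epairs (\<lambda>i. 1 / b i) n < 1"
    and "mono_on {1..n} b"
  shows "epairs (\<lambda>i. 1 / b i) n \<le> epairs (\<lambda>i. 1 / vseq i) n \<and>
    esum (\<lambda>i. 1 / b i) n \<le> esum (\<lambda>i. 1 / vseq i) n"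
  using assms
proof (induction n rule: less_induct)
  case (less n)
  define x where "x = (\<lambda>i. 1 / real (b i))"
  define y where "y = (\<lambda>i. 1 / vseq i)"
  have x: "x i > 0" if "i \<in> {1..n}" for i using less.prems(1) that by (simp add: x_def)
  have y: "y i > 0" if "i \<ge> 1" for i using vseq_ge_1[OF that] by (simp add: y_def)
  have x_antimono: "x j \<le> x i" if "1 \<le> i" "i \<le> j" "j \<le> n" for i j
    using mono_onD[OF less.prems(3), of i j] less.prems(1)[of i] that
    by (auto simp: x_def intro!: divide_left_mono)
  have y_antimono: "y (Suc i) \<le> y i" if "1 \<le> i" for i
    using vseq_le_Suc[OF that] vseq_ge_1[OF that] by (auto simp: y_def intro!: divide_left_mono)
  have before: "epairs x k \<le> epairs y k \<and> esum x k \<le> esum y k" if "k < n" for k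
    unfolding x_def y_def
  proof (rule less.IH[OF that])
    show "epairs (\<lambda>i. 1 / real (b i)) k < 1"
      using epairs_mono_length[of k n x] that x less.prems(2) by (auto simp: x_def)
    show "mono_on {1..k} b"
      using less.prems(3) that by (auto intro: mono_on_subset)
  qed (use less.prems(1) that in auto)
  show ?case
  proof (cases "n \<ge> 2")
    case False
    then have "n = 0 \<or> n = Suc 0" by auto
    then show ?thesis using less.prems(1)[of 1] by (auto simp: field_simps)
  next
    case n: True
    have e: "epairs x n \<le> epairs y n"
    proof (rule ccontr)
      assume "\<not> epairs x n \<le> epairs y n"
      then have gt: "epairs y n < epairs x n" by simp
      \<comment> \<open>\<open>epairs\<close> vanishes on prefixes of length 1, so the first entries
        are compared directly, through \<open>b 1 \<ge> 1 = vseq 1\<close>.\<close>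
      have "x 1 \<le> y 1" using less.prems(1)[of 1] n by (simp add: x_def y_def)
      then have "(\<Prod>i\<in>{1..n}. y i) \<le> (\<Prod>i\<in>{1..n}. x i)"
        using n x y gt before x_antimono by (intro prod_le_if_epairs_le) auto
      then have "1 / (\<Prod>i\<in>{1..n}. vseq i) \<le> 1 / (\<Prod>i\<in>{1..n}. real (b i))"
        by (simp add: x_def y_def prod_dividef)
      then show False
        using gt epairs_le_if_less_1[of n b] less.prems epairs_vseq[of n] n
        by (simp add: x_def y_def)
    qed
    moreover have "esum x n \<le> esum y n"
      by (rule esum_le_if_epairs_le[OF _ _ n _ _ _ e])
        (use x y x_antimono y_antimono before in auto)
    ultimately show ?thesis by (simp add: x_def y_def)
  qed
qed

text \<open>Sorting the list of values preserves its multiset, hence every sum of \<open>f\<close>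
  over the entries; no explicit permutation is needed.\<close>

lemma exists_sorted_rearrangement:
  fixes b :: "nat \<Rightarrow> 'a :: linorder"
  obtains c where "mono_on {1..n} c" "c ` {1..n} = b ` {1..n}"
    "\<And>f :: 'a \<Rightarrow> real. esum (\<lambda>i. f (c i)) n = esum (\<lambda>i. f (b i)) n"
proof -
  define xs where "xs = map b [1..<Suc n]"
  \<comment> \<open>The shift \<open>i - 1\<close> matches indices from 1 with list positions from
    0.\<close>
  define c where "c = (\<lambda>i. sort xs ! (i - 1))"
  have len: "length xs = n" by (simp add: xs_def del: upt_Suc)
  have map_c: "map c [1..<Suc n] = sort xs"
    by (rule nth_equalityI) (auto simp: c_def len xs_def simp del: upt_Suc)
  have esum_list: "esum g n = sum_list (map g [1..<Suc n])" for g :: "nat \<Rightarrow> real"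
    by (simp only: esum_def sum_list_distinct_conv_sum_set[OF distinct_upt] set_upt
        atLeastLessThanSuc_atLeastAtMost)
  show thesis
  proof (rule that)
    show "mono_on {1..n} c"
      by (rule mono_onI) (auto simp: c_def len intro!: sorted_nth_mono)
    have "c ` {1..n} = set (map c [1..<Suc n])" by (auto simp: atLeastLessThanSuc_atLeastAtMost)
    also have "\<dots> = b ` {1..n}" unfolding map_c by (auto simp: xs_def)
    finally show "c ` {1..n} = b ` {1..n}" .
    fix f :: "'a \<Rightarrow> real"
    have "esum (\<lambda>i. f (c i)) n = sum_list (map f (map c [1..<Suc n]))"
      by (simp add: esum_list comp_def del: upt_Suc)
    also have "\<dots> = sum_mset (image_mset f (mset (sort xs)))"
      unfolding map_c by (metis mset_map sum_mset_sum_list)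
    also have "\<dots> = sum_list (map f xs)"
      by (metis mset_map mset_sort sum_mset_sum_list)
    also have "\<dots> = esum (\<lambda>i. f (b i)) n"
      by (simp add: esum_list xs_def comp_def del: upt_Suc)
    finally show "esum (\<lambda>i. f (c i)) n = esum (\<lambda>i. f (b i)) n" .
  qed
qed

theorem theorem9:
  fixes n :: nat and b :: "nat \<Rightarrow> nat"
  assumes "n \<ge> 1"
    and "\<And>i. i \<in> {1..n} \<Longrightarrow> b i > 0"
    and "(\<Sum>(i, j)\<in>pairs n. 1 / (real (b i) * real (b j))) < 1"
  shows "(\<Sum>(i, j)\<in>pairs n. 1 / (real (b i) * real (b j)))
           \<le> (\<Sum>(i, j)\<in>pairs n. 1 / (vseq i * vseq j))
    \<and> (\<Sum>(i, j)\<in>pairs n. 1 / (vseq i * vseq j)) = 1 - 1 / (\<Prod>i\<in>{1..n}. vseq i)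
    \<and> (\<Sum>i\<in>{1..n}. 1 / real (b i)) \<le> (\<Sum>i\<in>{1..n}. 1 / vseq i)"
proof -
  have eb: "(\<Sum>(i, j)\<in>pairs n. 1 / (real (b i) * real (b j))) = epairs (\<lambda>i. 1 / real (b i)) n"
    and ev: "(\<Sum>(i, j)\<in>pairs n. 1 / (vseq i * vseq j)) = epairs (\<lambda>i. 1 / vseq i) n"
    by (simp_all add: epairs_def)
  obtain c where c: "mono_on {1..n} c" "c ` {1..n} = b ` {1..n}"
    "\<And>f :: nat \<Rightarrow> real. esum (\<lambda>i. f (c i)) n = esum (\<lambda>i. f (b i)) n"
    using exists_sorted_rearrangement[of n b] by blast
  have sum_c: "esum (\<lambda>i. 1 / real (c i)) n = esum (\<lambda>i. 1 / real (b i)) n"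
    by (rule c(3))
  \<comment> \<open>Newton's identity reduces the symmetry of \<open>epairs\<close> to that of the
    sums of entries and of their squares.\<close>
  have epairs_c: "epairs (\<lambda>i. 1 / real (c i)) n = epairs (\<lambda>i. 1 / real (b i)) n"
    unfolding epairs_eq sum_c by (simp only: c(3)[of "\<lambda>k. (1 / real k)\<^sup>2"])
  have "c i > 0" if "i \<in> {1..n}" for i
  proof -
    have "c i \<in> b ` {1..n}" using c(2) that by blast
    then show ?thesis using assms(2) by auto
  qed
  then have "epairs (\<lambda>i. 1 / real (c i)) n \<le> epairs (\<lambda>i. 1 / vseq i) n \<and>
      esum (\<lambda>i. 1 / real (c i)) n \<le> esum (\<lambda>i. 1 / vseq i) n"
    using c(1) assms(3) by (intro epairs_esum_le_vseq) (auto simp: epairs_c eb)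
  then show ?thesis
    unfolding eb ev using epairs_vseq[OF assms(1)] by (simp add: epairs_c sum_c) (simp add: esum_def)
qed

end
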